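(* Let $n\ge 2$ and $r\ge 1$ be integers, let $\omega=e^{2\pi i/n}$, let $f:\mathbf{Z}_n^r\to\mathbf{Z}_n$ be a function, and let $$|\Psi_f\rangle=\mathcal{F}_n^{\otimes (r+1)}\,U_f\,\mathcal{F}_n^{\otimes (r+1)}\,\bigl(|0\rangle^{\otimes r}\otimes|1\rangle\bigr)$$ be the output state of the $n$-ary Deutsch-Jozsa circuit, which uses the oracle $U_f$ exactly once. Then: (i) (Distinguishing constant from balanced.) If $f$ is constant, then measuring the $x$-register of $|\Psi_f\rangle$ in the computational basis gives the outcome $(0,\ldots,0)$ with probability $1$. If $f$ is balanced, then this measurement gives the outcome $(0,\ldots,0)$ with probability $0$. (ii) (Determining an affine function up to its constant term.) If $f$ is affine, i.e. $f(x_1,\ldots,x_r)=A_0+A_1x_1+\cdots+A_rx_r$ (arithmetic in $\mathbf{Z}_n$) with $A_0,A_1,\ldots,A_r\in\mathbf{Z}_n$, then $$|\Psi_f\rangle=\omega^{-A_0}\,|A_1,\ldots,A_r\rangle\otimes|n-1\rangle .$$ That is, the $x$-register at output is $\omega^{-A_0}|A_1,\ldots,A_r\rangle$, with $A_0$ appearing only in the phase. Consequently, measuring the $x$-register in the computational basis gives the outcome $(A_1,\ldots,A_r)$ with probability $1$, whatever the value of $A_0$.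
   Context: Let $\mathcal{H}_n=\mathbb{C}^n$ with orthonormal computational basis $|0\rangle,\ldots,|n-1\rangle$ indexed by $\mathbf{Z}_n=\mathbb{Z}/n\mathbb{Z}$. The state space of the circuit is $\mathcal{H}_n^{\otimes r}\otimes\mathcal{H}_n$. The first $r$ tensor factors form the $x$-register, with basis $|x\rangle=|x_1,\ldots,x_r\rangle=|x_1\rangle\otimes\cdots\otimes|x_r\rangle$ for $x=(x_1,\ldots,x_r)\in\mathbf{Z}_n^r$. The last factor is the $y$-register. The quantum Fourier transform is the linear operator on $\mathcal{H}_n$ given by $\mathcal{F}_n=\frac{1}{\sqrt n}\sum_{j=0}^{n-1}\sum_{k=0}^{n-1}e^{2\pi i jk/n}|j\rangle\langle k|$. The operator $\mathcal{F}_n^{\otimes(r+1)}$ acts on each of the $r+1$ tensor factors. The oracle of $f:\mathbf{Z}_n^r\to\mathbf{Z}_n$ is the linear operator $U_f$ on $\mathcal{H}_n^{\otimes r}\otimes\mathcal{H}_n$ with $U_f\bigl(|x\rangle\otimes|y\rangle\bigr)=|x\rangle\otimes|y+f(x)\rangle$ for $x\in\mathbf{Z}_n^r$, $y\in\mathbf{Z}_n$, with addition modulo $n$. The function $f$ is constant if $f(x)=f(x')$ for all $x,x'\in\mathbf{Z}_n^r$. It is balanced if every element of $\mathbf{Z}_n$ has exactly $n^{r-1}$ preimages under $f$. For a unit vector $|\Psi\rangle\in\mathcal{H}_n^{\otimes r}\otimes\mathcal{H}_n$, measuring the $x$-register in the computational basis gives the outcome $a\in\mathbf{Z}_n^r$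 with probability $\sum_{y\in\mathbf{Z}_n}\bigl|(\langle a|\otimes\langle y|)|\Psi\rangle\bigr|^2$. *)

theory Defs
  imports "Jordan_Normal_Form.Matrix" "Jordan_Normal_Form.Conjugate" Complex_Main
    "HOL-Library.FuncSet"
begin

text \<open>
  Vectors and matrices are those of \<^theory>\<open>Jordan_Normal_Form.Matrix\<close>. The space of dimension \<open>m\<close> is
  \<open>carrier_vec m\<close>, and the tensor product of the spaces of dimensions \<open>m\<close> and \<open>n\<close> is identified
  with \<open>carrier_vec (m * n)\<close> by the Kronecker product: the product of the basis vectors \<open>i\<close> and \<open>j\<close>
  is the basis vector \<open>i * n + j\<close>.
\<close>

definition tensor_vec :: "complex vec \<Rightarrow> complex vec \<Rightarrow> complex vec" (infixl \<open>\<otimes>\<^sub>v\<close> 75) where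
  "v \<otimes>\<^sub>v w = vec (dim_vec v * dim_vec w) (\<lambda>i. v $ (i div dim_vec w) * w $ (i mod dim_vec w))"

definition tensor_mat :: "complex mat \<Rightarrow> complex mat \<Rightarrow> complex mat" (infixl \<open>\<otimes>\<^sub>m\<close> 75) where
  "A \<otimes>\<^sub>m B = mat (dim_row A * dim_row B) (dim_col A * dim_col B)
     (\<lambda>(i, j). A $$ (i div dim_row B, j div dim_col B) * B $$ (i mod dim_row B, j mod dim_col B))"

fun tensor_pow :: "complex mat \<Rightarrow> nat \<Rightarrow> complex mat" where
  "tensor_pow A 0 = 1\<^sub>m 1"
| "tensor_pow A (Suc k) = tensor_pow A k \<otimes>\<^sub>m A"

text \<open>
  Residues modulo \<open>n\<close> are represented by \<open>{..<n}\<close>, and a tuple \<open>(x\<^sub>1, \<dots>, x\<^sub>r)\<close> of residues by an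
  extensional function on \<open>{1..r}\<close>.
\<close>

definition Zpow :: "nat \<Rightarrow> nat \<Rightarrow> (nat \<Rightarrow> nat) set" where
  "Zpow n r = {1..r} \<rightarrow>\<^sub>E {..<n}"

definition ket :: "nat \<Rightarrow> nat \<Rightarrow> complex vec" where
  "ket n j = unit_vec n j"

fun ket_reg :: "nat \<Rightarrow> nat \<Rightarrow> (nat \<Rightarrow> nat) \<Rightarrow> complex vec" where
  "ket_reg n 0 x = unit_vec 1 0"
| "ket_reg n (Suc k) x = ket_reg n k x \<otimes>\<^sub>v ket n (x (Suc k))"

definition qft :: "nat \<Rightarrow> complex mat" where
  "qft n = complex_of_real (1 / sqrt (real n)) \<cdot>\<^sub>m
     mat n n (\<lambda>(j, k). exp (2 * complex_of_real pi * \<i> * of_nat j * of_nat k / of_nat n))"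

text \<open>
  The query operator of \<open>f\<close> is the sum over \<open>x\<close> and \<open>y\<close> of the outer products
  \<open>|x, y + f x\<rangle>\<langle>x, y|\<close>, written entry by entry because \<open>mat\<close> has no \<open>\<Sum>\<close>; the
  action on basis vectors is \<open>oracle_op_ket\<close> below.
\<close>

definition oracle_op :: "nat \<Rightarrow> nat \<Rightarrow> ((nat \<Rightarrow> nat) \<Rightarrow> nat) \<Rightarrow> complex mat" where
  "oracle_op n r f = mat (n ^ r * n) (n ^ r * n) (\<lambda>(i, j).
     \<Sum>x\<in>Zpow n r. \<Sum>y<n.
       (ket_reg n r x \<otimes>\<^sub>v ket n ((y + f x) mod n)) $ i * cnj ((ket_reg n r x \<otimes>\<^sub>v ket n y) $ j))"

definition dj_state :: "nat \<Rightarrow> nat \<Rightarrow> ((nat \<Rightarrow> nat) \<Rightarrow> nat) \<Rightarrow> complex vec" where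
  "dj_state n r f = tensor_pow (qft n) (r + 1) *\<^sub>v (oracle_op n r f *\<^sub>v
     (tensor_pow (qft n) (r + 1) *\<^sub>v (ket_reg n r (\<lambda>i\<in>{1..r}. 0) \<otimes>\<^sub>v ket n 1)))"

text \<open>
  \<open>\<bullet>c\<close> conjugates its second argument, so \<open>\<Psi> \<bullet>c v\<close> is \<open>\<langle>v|\<Psi>\<rangle>\<close>.
\<close>

definition prob_x_outcome :: "nat \<Rightarrow> nat \<Rightarrow> complex vec \<Rightarrow> (nat \<Rightarrow> nat) \<Rightarrow> real" where
  "prob_x_outcome n r \<Psi> a = (\<Sum>y<n. (cmod (\<Psi> \<bullet>c (ket_reg n r a \<otimes>\<^sub>v ket n y)))\<^sup>2)"

definition constant_fun :: "nat \<Rightarrow> nat \<Rightarrow> ((nat \<Rightarrow> nat) \<Rightarrow> nat) \<Rightarrow> bool" where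
  "constant_fun n r f \<longleftrightarrow> (\<forall>x\<in>Zpow n r. \<forall>x'\<in>Zpow n r. f x = f x')"

definition balanced_fun :: "nat \<Rightarrow> nat \<Rightarrow> ((nat \<Rightarrow> nat) \<Rightarrow> nat) \<Rightarrow> bool" where
  "balanced_fun n r f \<longleftrightarrow> (\<forall>z<n. card {x \<in> Zpow n r. f x = z} = n ^ (r - 1))"

lemma dim_tensor_vec [simp]: "dim_vec (v \<otimes>\<^sub>v w) = dim_vec v * dim_vec w"
  by (simp add: tensor_vec_def)

lemma dim_ket [simp]: "dim_vec (ket n j) = n"
  by (simp add: ket_def)

lemma dim_ket_reg [simp]: "dim_vec (ket_reg n r x) = n ^ r"
  by (induction r) auto

lemma sum_div_mod:
  fixes g h :: "nat \<Rightarrow> complex"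
  shows "(\<Sum>i<m * n. g (i div n) * h (i mod n)) = (\<Sum>i<m. g i) * (\<Sum>j<n. h j)"
proof (cases "n = 0")
  case False
  show ?thesis
  proof (induction m)
    case (Suc m)
    have "(\<Sum>i<Suc m * n. g (i div n) * h (i mod n)) =
        (\<Sum>i<m * n. g (i div n) * h (i mod n)) +
        (\<Sum>i\<in>{m * n..<m * n + n}. g (i div n) * h (i mod n))"
      by (subst sum.union_disjoint [symmetric]) (auto intro!: sum.cong)
    also have "(\<Sum>i\<in>{m * n..<m * n + n}. g (i div n) * h (i mod n)) = (\<Sum>j<n. g m * h j)"
      using sum.shift_bounds_nat_ivl [of "\<lambda>i. g (i div n) * h (i mod n)" 0 "m * n" n] False
      by (simp add: lessThan_atLeast0 add.commute)
    finally show ?case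
      by (simp add: Suc.IH sum_distrib_left algebra_simps)
  qed simp
qed simp

lemma cscalar_tensor_vec:
  assumes "dim_vec v = dim_vec v'" "dim_vec w = dim_vec w'"
  shows "(v \<otimes>\<^sub>v w) \<bullet>c (v' \<otimes>\<^sub>v w') = (v \<bullet>c v') * (w \<bullet>c w')"
proof -
  have "(v \<otimes>\<^sub>v w) \<bullet>c (v' \<otimes>\<^sub>v w') = (\<Sum>i<dim_vec v' * dim_vec w'.
      (v $ (i div dim_vec w') * cnj (v' $ (i div dim_vec w'))) *
      (w $ (i mod dim_vec w') * cnj (w' $ (i mod dim_vec w'))))"
    by (auto simp: scalar_prod_def tensor_vec_def assms lessThan_atLeast0 intro!: sum.cong)
  also have "\<dots> = (\<Sum>i<dim_vec v'. v $ i * cnj (v' $ i)) * (\<Sum>i<dim_vec w'. w $ i * cnj (w' $ i))"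
    by (rule sum_div_mod)
  finally show ?thesis
    by (simp add: scalar_prod_def lessThan_atLeast0)
qed

lemma cscalar_ket:
  assumes "i < n" "j < n"
  shows "ket n i \<bullet>c ket n j = (if i = j then 1 else 0)"
  using assms by (auto simp: ket_def scalar_prod_def unit_vec_def sum.delta if_distrib
      [where f = "\<lambda>x. x * _"] if_distrib [where f = conjugate] cong: if_cong)

lemma cscalar_ket_reg:
  assumes "\<And>i. i \<in> {1..r} \<Longrightarrow> x i < n \<and> x' i < n"
  shows "ket_reg n r x \<bullet>c ket_reg n r x' = (if \<forall>i\<in>{1..r}. x i = x' i then 1 else 0)"
  using assms
proof (induction r)
  case 0
  show ?case by (simp add: scalar_prod_def)
next
  case (Suc r)
  have "ket_reg n r x \<bullet>c ket_reg n r x' = (if \<forall>i\<in>{1..r}. x i = x' i then 1 else 0)"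
    by (rule Suc.IH) (use Suc.prems in auto)
  moreover have "ket n (x (Suc r)) \<bullet>c ket n (x' (Suc r)) = (if x (Suc r) = x' (Suc r) then 1 else 0)"
    by (rule cscalar_ket) (use Suc.prems in auto)
  ultimately show ?case
    by (auto simp: cscalar_tensor_vec atLeastAtMostSuc_conv)
qed

lemma cscalar_ket_xy:
  assumes "x \<in> Zpow n r" "x' \<in> Zpow n r" "y < n" "y' < n"
  shows "(ket_reg n r x \<otimes>\<^sub>v ket n y) \<bullet>c (ket_reg n r x' \<otimes>\<^sub>v ket n y') =
    (if x = x' \<and> y = y' then 1 else 0)"
proof -
  have "(\<forall>i\<in>{1..r}. x i = x' i) \<longleftrightarrow> x = x'"
    using assms(1,2) by (auto simp: Zpow_def intro: PiE_ext)
  moreover have "ket_reg n r x \<bullet>c ket_reg n r x' = (if \<forall>i\<in>{1..r}. x i = x' i then 1 else 0)"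
    by (rule cscalar_ket_reg) (use assms(1,2) in \<open>auto simp: Zpow_def PiE_iff\<close>)
  ultimately show ?thesis
    using assms(3,4) by (simp add: cscalar_tensor_vec cscalar_ket)
qed

lemma finite_Zpow [simp]: "finite (Zpow n r)"
  by (simp add: Zpow_def finite_PiE)

lemma oracle_op_ket:
  assumes x: "x \<in> Zpow n r" and y: "y < n"
  shows "oracle_op n r f *\<^sub>v (ket_reg n r x \<otimes>\<^sub>v ket n y) =
    ket_reg n r x \<otimes>\<^sub>v ket n ((y + f x) mod n)"
proof (rule eq_vecI)
  fix i assume "i < dim_vec (ket_reg n r x \<otimes>\<^sub>v ket n ((y + f x) mod n))"
  then have i: "i < n ^ r * n" by simp
  let ?K = "\<lambda>x y. ket_reg n r x \<otimes>\<^sub>v ket n y"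
  let ?A = "\<lambda>x' y'. ?K x' ((y' + f x') mod n) $ i"
  have "(oracle_op n r f *\<^sub>v ?K x y) $ i =
      (\<Sum>j<n ^ r * n. \<Sum>x'\<in>Zpow n r. \<Sum>y'<n. ?A x' y' * (?K x y $ j * cnj (?K x' y' $ j)))"
    using i by (simp add: oracle_op_def scalar_prod_def lessThan_atLeast0 sum_distrib_right
        sum_distrib_left mult_ac)
  also have "\<dots> = (\<Sum>x'\<in>Zpow n r. \<Sum>y'<n. ?A x' y' * (?K x y \<bullet>c ?K x' y'))"
    by (subst sum.swap, rule sum.cong [OF refl], subst sum.swap)
      (simp add: scalar_prod_def lessThan_atLeast0 sum_distrib_left)
  also have "\<dots> = (\<Sum>x'\<in>Zpow n r. \<Sum>y'<n. if x' = x then if y' = y then ?A x y else 0 else 0)"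
    by (intro sum.cong refl) (use x y in \<open>auto simp: cscalar_ket_xy\<close>)
  also have "\<dots> = (\<Sum>x'\<in>Zpow n r. if x' = x then ?A x y else 0)"
    by (intro sum.cong refl) (use y in \<open>auto simp: sum.delta\<close>)
  also have "\<dots> = ?A x y"
    using x by (simp add: sum.delta)
  finally show "(oracle_op n r f *\<^sub>v ?K x y) $ i = ?K x ((y + f x) mod n) $ i" .
qed (simp add: oracle_op_def)

end

theory Submission
  imports Defs
begin

text \<open>
  Phase kickback: the Fourier transform of \<open>|1\<rangle>\<close> is an eigenvector of every translation of the
  \<open>y\<close>-register, so a query multiplies the amplitude of \<open>|x\<rangle>\<close> by \<open>\<omega>\<close> to the power \<open>-f x\<close>, and the
  last Fourier transform turns the \<open>y\<close>-register into \<open>|n - 1\<rangle>\<close>. The output amplitude of \<open>|a\<rangle>\<close> in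
  the \<open>x\<close>-register is then the average over \<open>x\<close> of \<open>\<omega>\<close> to the power \<open>a \<bullet> x - f x\<close>, and
  orthogonality of the characters of \<open>\<int>/n\<close> evaluates it in each of the three cases.
\<close>

section \<open>Characters of the integers modulo \<open>n\<close>\<close>

text \<open>This is \<omega> to the power \<open>k\<close>. Integer exponents admit the phases
  \<open>- int (f x)\<close> and differences of linear forms. For \<open>n = 0\<close>, division by
  zero makes it constantly 1.\<close>

definition unity_exp :: "nat \<Rightarrow> int \<Rightarrow> complex" where
  "unity_exp n k = cis (2 * pi * of_int k / of_nat n)"

lemma unity_exp_0 [simp]: "unity_exp n 0 = 1"
  by (simp add: unity_exp_def)

lemma norm_unity_exp [simp]: "cmod (unity_exp n k) = 1"
  by (simp add: unity_exp_def)

lemma unity_exp_add: "unity_exp n (k + l) = unity_exp n k * unity_exp n l"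
  by (simp add: unity_exp_def cis_mult add_divide_distrib ring_distribs)

lemma unity_exp_sum: "finite S \<Longrightarrow> unity_exp n (\<Sum>i\<in>S. g i) = (\<Prod>i\<in>S. unity_exp n (g i))"
  by (induction S rule: finite_induct) (simp_all add: unity_exp_add)

lemma unity_exp_power: "unity_exp n k ^ m = unity_exp n (k * int m)"
  by (simp add: unity_exp_def DeMoivre mult_ac)

lemma unity_exp_eq_1_iff:
  assumes "n > 0"
  shows "unity_exp n k = 1 \<longleftrightarrow> int n dvd k"
proof -
  \<comment> \<open>The cosine is 1 exactly at integer multiples of \<open>2 * pi\<close>, and the
    sine vanishes there, so the imaginary part adds no condition.\<close>
  have "unity_exp n k = 1 \<longleftrightarrow> (\<exists>m::int. 2 * pi * of_int k / of_nat n = of_int m * (2 * pi))"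
    unfolding unity_exp_def complex_eq_iff
    by (auto simp: cos_one_2pi_int cos_one_sin_zero mult_ac)
  also have "\<dots> \<longleftrightarrow> (\<exists>m::int. real_of_int k = of_int (int n * m))"
    using assms by (intro ex_cong1) (auto simp: field_simps)
  also have "\<dots> \<longleftrightarrow> int n dvd k"
    unfolding of_int_eq_iff by (auto simp: dvd_def)
  finally show ?thesis .
qed

lemma dvd_diff_less_iff:
  assumes "j < n" "k < n"
  shows "int n dvd int j - int k \<longleftrightarrow> j = k"
  using assms by (simp flip: mod_eq_dvd_iff zmod_int)

lemma unity_exp_cong:
  assumes "int n dvd k - l"
  shows "unity_exp n k = unity_exp n l"
proof (cases "n = 0")
  case False
  then have "unity_exp n (k - l) = 1"
    using assms by (simp add: unity_exp_eq_1_iff)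
  then show ?thesis
    using unity_exp_add [of n "k - l" l] by simp
qed (simp add: unity_exp_def)

text \<open>A geometric sum with ratio \<open>unity_exp n k\<close>, whose \<open>n\<close>-th power
  is 1: either the ratio is 1 and all terms are 1, or the closed form has numerator 0.\<close>

lemma sum_unity_exp:
  assumes "n > 0"
  shows "(\<Sum>z<n. unity_exp n (k * int z)) = (if int n dvd k then of_nat n else 0)"
proof (cases "int n dvd k")
  case True
  then have "unity_exp n k = 1"
    using assms by (simp add: unity_exp_eq_1_iff)
  then show ?thesis
    using True by (simp flip: unity_exp_power)
next
  case False
  then have "unity_exp n k \<noteq> 1" "unity_exp n k ^ n = 1"
    using assms by (simp_all add: unity_exp_eq_1_iff unity_exp_power)
  then show ?thesis
    using False geometric_sum [of "unity_exp n k" n] by (simp flip: unity_exp_power)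
qed

text \<open>Links the \<omega> of the theorem to the characters used in the computation.\<close>

lemma powi_exp_eq_unity_exp:
  "exp (2 * complex_of_real pi * \<i> / of_nat n) powi k = unity_exp n k"
proof -
  have "exp (2 * complex_of_real pi * \<i> / of_nat n) = cis (2 * pi / of_nat n)"
    by (simp add: cis_conv_exp mult_ac)
  then show ?thesis
    by (simp add: unity_exp_def cis_power_int mult_ac)
qed

section \<open>Tensor products and the Fourier transform of one factor\<close>

text \<open>Each summand of the matrix-vector product is a function of
  \<open>j div dim_vec w\<close> times a function of \<open>j mod dim_vec w\<close>, so
  \<open>sum_div_mod\<close> splits the sum.\<close>

lemma tensor_mat_mult_vec:
  assumes "dim_col A = dim_vec v" "dim_col B = dim_vec w"
  shows "(A \<otimes>\<^sub>m B) *\<^sub>v (v \<otimes>\<^sub>v w) = (A *\<^sub>v v) \<otimes>\<^sub>v (B *\<^sub>v w)"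
proof (rule eq_vecI)
  fix i assume "i < dim_vec ((A *\<^sub>v v) \<otimes>\<^sub>v (B *\<^sub>v w))"
  then have i: "i < dim_row A * dim_row B" by simp
  then have "dim_row B > 0" by (cases "dim_row B") auto
  with i have i': "i div dim_row B < dim_row A" "i mod dim_row B < dim_row B"
    by (auto simp: less_mult_imp_div_less)
  have "((A \<otimes>\<^sub>m B) *\<^sub>v (v \<otimes>\<^sub>v w)) $ i = (\<Sum>j<dim_vec v * dim_vec w.
      (A $$ (i div dim_row B, j div dim_vec w) * v $ (j div dim_vec w)) *
      (B $$ (i mod dim_row B, j mod dim_vec w) * w $ (j mod dim_vec w)))"
    using i assms by (simp add: tensor_mat_def tensor_vec_def scalar_prod_def lessThan_atLeast0 mult_ac)
  also have "\<dots> = (\<Sum>j<dim_vec v. A $$ (i div dim_row B, j) * v $ j) *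
      (\<Sum>j<dim_vec w. B $$ (i mod dim_row B, j) * w $ j)"
    by (rule sum_div_mod)
  also have "\<dots> = ((A *\<^sub>v v) \<otimes>\<^sub>v (B *\<^sub>v w)) $ i"
    using i i' assms by (simp add: tensor_vec_def scalar_prod_def lessThan_atLeast0)
  finally show "((A \<otimes>\<^sub>m B) *\<^sub>v (v \<otimes>\<^sub>v w)) $ i = ((A *\<^sub>v v) \<otimes>\<^sub>v (B *\<^sub>v w)) $ i" .
qed (simp add: tensor_mat_def)

lemma dim_qft [simp]: "dim_row (qft n) = n" "dim_col (qft n) = n"
  by (simp_all add: qft_def)

lemma dim_tensor_pow [simp]:
  "dim_row (tensor_pow A k) = dim_row A ^ k" "dim_col (tensor_pow A k) = dim_col A ^ k"
  by (induction k) (simp_all add: tensor_mat_def)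

lemma qft_index:
  assumes "j < n" "k < n"
  shows "qft n $$ (j, k) = unity_exp n (int j * int k) / sqrt n"
  using assms by (simp add: qft_def unity_exp_def cis_conv_exp mult_ac)

lemma qft_mult_vec_index:
  assumes "j < n" "dim_vec v = n"
  shows "(qft n *\<^sub>v v) $ j = (\<Sum>k<n. unity_exp n (int j * int k) * v $ k) / sqrt n"
proof -
  have "(qft n *\<^sub>v v) $ j = (\<Sum>k<n. qft n $$ (j, k) * v $ k)"
    using assms by (simp add: scalar_prod_def lessThan_atLeast0)
  also have "\<dots> = (\<Sum>k<n. unity_exp n (int j * int k) * v $ k / sqrt n)"
    using assms by (intro sum.cong) (simp_all add: qft_index)
  finally show ?thesis
    by (simp add: sum_divide_distrib)
qed

lemma qft_ket_index:
  assumes "j < n" "k < n"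
  shows "(qft n *\<^sub>v ket n k) $ j = unity_exp n (int j * int k) / sqrt n"
proof -
  have "(\<Sum>l<n. unity_exp n (int j * int l) * ket n k $ l) =
      (\<Sum>l<n. if l = k then unity_exp n (int j * int k) else 0)"
    using assms by (intro sum.cong) (auto simp: ket_def)
  then show ?thesis
    using assms by (simp add: qft_mult_vec_index del: index_mult_mat_vec)
qed

text \<open>The square of the Fourier transform negates basis labels, and \<open>n - 1\<close>
  represents -1.\<close>

lemma qft_qft_ket_1:
  assumes "n \<ge> 2"
  shows "qft n *\<^sub>v (qft n *\<^sub>v ket n 1) = ket n (n - 1)"
proof (rule eq_vecI)
  fix j assume "j < dim_vec (ket n (n - 1))"
  then have j: "j < n" by simp
  have "(qft n *\<^sub>v (qft n *\<^sub>v ket n 1)) $ j =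
      (\<Sum>k<n. unity_exp n (int j * int k) * (qft n *\<^sub>v ket n 1) $ k) / sqrt n"
    using j by (simp add: qft_mult_vec_index del: index_mult_mat_vec)
  also have "(\<Sum>k<n. unity_exp n (int j * int k) * (qft n *\<^sub>v ket n 1) $ k) =
      (\<Sum>k<n. unity_exp n ((int j + 1) * int k)) / sqrt n"
    using assms unfolding sum_divide_distrib
    by (intro sum.cong) (simp_all add: qft_ket_index unity_exp_add ring_distribs del: index_mult_mat_vec)
  also have "\<dots> / sqrt n = (if int n dvd int j + 1 then 1 else 0)"
    using assms by (simp add: sum_unity_exp flip: of_real_mult)
  \<comment> \<open>Since \<open>j + 1\<close> lies between 1 and \<open>n\<close>, its only
    possible multiple of \<open>n\<close> is \<open>n\<close> itself.\<close>
  also have "int n dvd int j + 1 \<longleftrightarrow> j = n - 1"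
    using j zdvd_imp_le [of "int n" "int j + 1"] by auto
  finally show "(qft n *\<^sub>v (qft n *\<^sub>v ket n 1)) $ j = ket n (n - 1) $ j"
    using j by (simp add: ket_def)
qed simp

section \<open>Computational basis of the \<open>x\<close>-register\<close>

lemma cscalar_ket_right:
  assumes "dim_vec v = n" "j < n"
  shows "v \<bullet>c ket n j = v $ j"
proof -
  have "v \<bullet>c ket n j = (\<Sum>l<n. if l = j then v $ j else 0)"
    using assms unfolding scalar_prod_def
    by (intro sum.cong) (auto simp: ket_def)
  then show ?thesis
    using assms by simp
qed

lemma mult_add_less:
  fixes i j m n :: nat
  assumes "i < m" "j < n"
  shows "i * n + j < m * n"
proof -
  have "i * n + j < Suc i * n" using assms by simp
  also have "\<dots> \<le> m * n" using assms by (intro mult_right_mono) auto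
  finally show ?thesis .
qed

lemma tensor_ket_ket:
  assumes "i < m" "j < n"
  shows "ket m i \<otimes>\<^sub>v ket n j = ket (m * n) (i * n + j)"
proof (rule eq_vecI)
  fix l assume "l < dim_vec (ket (m * n) (i * n + j))"
  then have l: "l < m * n" by simp
  have "l div n = i \<and> l mod n = j \<longleftrightarrow> l = i * n + j"
    using assms by (auto simp: div_mult_mod_eq)
  moreover have "i * n + j < m * n"
    using assms by (rule mult_add_less)
  moreover have "l div n < m" "l mod n < n"
    using l assms by (auto simp: less_mult_imp_div_less)
  ultimately show "(ket m i \<otimes>\<^sub>v ket n j) $ l = ket (m * n) (i * n + j) $ l"
    using l assms by (auto simp: tensor_vec_def ket_def)
qed simp

text \<open>The index is the number with base-\<open>n\<close> digits \<open>x 1\<close>, ...,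
  \<open>x r\<close>, most significant first; each further tensor factor appends a digit.\<close>

lemma ket_reg_eq_ket:
  assumes "\<And>i. i \<in> {1..r} \<Longrightarrow> x i < n"
  shows "\<exists>i<n ^ r. ket_reg n r x = ket (n ^ r) i"
  using assms
proof (induction r)
  case (Suc r)
  then obtain i where i: "i < n ^ r" "ket_reg n r x = ket (n ^ r) i"
    by fastforce
  moreover have "x (Suc r) < n"
    using Suc.prems by simp
  ultimately show ?case
    using mult_add_less [of i "n ^ r" "x (Suc r)" n]
    by (auto simp: tensor_ket_ket mult.commute)
qed (simp add: ket_def)

lemma ket_reg_cong:
  "(\<And>i. i \<in> {1..r} \<Longrightarrow> x i = x' i) \<Longrightarrow> ket_reg n r x = ket_reg n r x'"
  by (induction r) simp_all

text \<open>The converse reads off the base-\<open>n\<close> digits of \<open>i\<close>: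
  \<open>i mod n\<close> is the last one and \<open>i div n\<close> carries the others.\<close>

lemma ket_eq_ket_reg:
  assumes "i < n ^ r"
  shows "\<exists>x\<in>Zpow n r. ket_reg n r x = ket (n ^ r) i"
  using assms
proof (induction r arbitrary: i)
  case 0
  then show ?case by (simp add: ket_def Zpow_def)
next
  case (Suc r)
  then have n: "n > 0" by (cases n) auto
  have "i div n < n ^ r"
    using Suc.prems by (simp add: less_mult_imp_div_less mult.commute)
  then obtain x where x: "x \<in> Zpow n r" "ket_reg n r x = ket (n ^ r) (i div n)"
    using Suc.IH by blast
  have "ket_reg n r (x(Suc r := i mod n)) = ket_reg n r x"
    by (rule ket_reg_cong) auto
  then have "ket_reg n (Suc r) (x(Suc r := i mod n)) = ket (n ^ Suc r) i"
    using x n \<open>i div n < n ^ r\<close> by (simp add: tensor_ket_ket mult.commute)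
  moreover have "x(Suc r := i mod n) \<in> Zpow n (Suc r)"
    using x n by (auto simp: Zpow_def PiE_iff extensional_def)
  ultimately show ?case by blast
qed

text \<open>The register kets exhaust the standard basis, so these inner products are all the
  coordinates. This turns a computation of amplitudes into an equality of states.\<close>

lemma vec_eq_ket_regI:
  assumes "dim_vec v = n ^ r" "dim_vec w = n ^ r"
    and "\<And>a. a \<in> Zpow n r \<Longrightarrow> v \<bullet>c ket_reg n r a = w \<bullet>c ket_reg n r a"
  shows "v = w"
proof (rule eq_vecI)
  fix i assume "i < dim_vec w"
  then have i: "i < n ^ r" using assms by simp
  then obtain a where "a \<in> Zpow n r" "ket_reg n r a = ket (n ^ r) i"
    using ket_eq_ket_reg by blast
  then show "v $ i = w $ i"
    using assms(3) [of a] i by (simp add: cscalar_ket_right assms(1,2))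
qed (simp add: assms)

section \<open>Fourier transform and superpositions of the register\<close>

text \<open>Matrix elements multiply over tensor factors, so exponents add. The hypotheses use plain
  function sets instead of \<open>Zpow\<close> because extensionality is lost when the induction
  drops the last coordinate.\<close>

lemma tensor_pow_qft_ket_reg:
  assumes "a \<in> {1..r} \<rightarrow> {..<n}" "x \<in> {1..r} \<rightarrow> {..<n}"
  shows "(tensor_pow (qft n) r *\<^sub>v ket_reg n r x) \<bullet>c ket_reg n r a =
    unity_exp n (\<Sum>i=1..r. int (a i) * int (x i)) / sqrt n ^ r"
  using assms
proof (induction r)
  case 0
  then show ?case by (simp add: scalar_prod_def)
next
  case (Suc r)
  have IH: "(tensor_pow (qft n) r *\<^sub>v ket_reg n r x) \<bullet>c ket_reg n r a =
      unity_exp n (\<Sum>i=1..r. int (a i) * int (x i)) / sqrt n ^ r"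
    by (rule Suc.IH) (use Suc.prems in auto)
  have "a (Suc r) < n" "x (Suc r) < n"
    using Suc.prems by auto
  then have "(qft n *\<^sub>v ket n (x (Suc r))) \<bullet>c ket n (a (Suc r)) =
      unity_exp n (int (a (Suc r)) * int (x (Suc r))) / sqrt n"
    by (simp add: cscalar_ket_right qft_ket_index del: index_mult_mat_vec)
  then show ?case
    using IH by (simp add: tensor_mat_mult_vec cscalar_tensor_vec unity_exp_add mult_ac)
qed

text \<open>Indexing the coefficients by tuples lets the oracle act on them by a pointwise
  phase.\<close>

definition reg_superpos :: "nat \<Rightarrow> nat \<Rightarrow> ((nat \<Rightarrow> nat) \<Rightarrow> complex) \<Rightarrow> complex vec" where
  "reg_superpos n r c = vec (n ^ r) (\<lambda>i. \<Sum>x\<in>Zpow n r. c x * ket_reg n r x $ i)"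

lemma dim_reg_superpos [simp]: "dim_vec (reg_superpos n r c) = n ^ r"
  by (simp add: reg_superpos_def)

text \<open>Linearity of \<open>M\<close>: the inner product with a register ket is a single
  coordinate, where the two finite sums can be exchanged.\<close>

lemma mult_reg_superpos_cscalar:
  assumes "dim_row M = n ^ r" "dim_col M = n ^ r" "a \<in> Zpow n r"
  shows "(M *\<^sub>v reg_superpos n r c) \<bullet>c ket_reg n r a =
    (\<Sum>x\<in>Zpow n r. c x * ((M *\<^sub>v ket_reg n r x) \<bullet>c ket_reg n r a))"
proof -
  obtain i where i: "i < n ^ r" "ket_reg n r a = ket (n ^ r) i"
    using ket_reg_eq_ket [of r a n] assms(3) by (auto simp: Zpow_def PiE_iff)
  have "(M *\<^sub>v reg_superpos n r c) $ i =
      (\<Sum>j<n ^ r. \<Sum>x\<in>Zpow n r. c x * (M $$ (i, j) * ket_reg n r x $ j))"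
    using i assms by (simp add: reg_superpos_def scalar_prod_def lessThan_atLeast0
        sum_distrib_left mult_ac)
  also have "\<dots> = (\<Sum>x\<in>Zpow n r. c x * (M *\<^sub>v ket_reg n r x) $ i)"
    by (subst sum.swap)
      (use i assms in \<open>simp add: scalar_prod_def lessThan_atLeast0 sum_distrib_left\<close>)
  finally show ?thesis
    using i assms by (simp add: cscalar_ket_right del: index_mult_mat_vec)
qed

section \<open>Phase kickback\<close>

text \<open>The left side is entry \<open>j\<close> of the translate by \<open>s\<close> of the
  transformed \<open>|1\<rangle>\<close>; the eigenvalue is the phase lost in replacing
  \<open>y\<close> by \<open>y + s\<close>.\<close>

lemma translate_qft_ket_1:
  assumes "n \<ge> 2" "j < n"
  shows "(\<Sum>y<n. ket n ((y + s) mod n) $ j * (qft n *\<^sub>v ket n 1) $ y) =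
    unity_exp n (- int s) * (qft n *\<^sub>v ket n 1) $ j"
proof -
  let ?\<chi> = "qft n *\<^sub>v ket n 1"
  have n: "n > 0" using assms by simp
  have bij: "bij_betw (\<lambda>y. (y + s) mod n) {..<n} {..<n}"
  proof -
    have "inj_on (\<lambda>y. (y + s) mod n) {..<n}"
    proof (rule inj_onI)
      fix y z assume "y \<in> {..<n}" "z \<in> {..<n}" "(y + s) mod n = (z + s) mod n"
      moreover from this(3) have "int n dvd int (y + s) - int (z + s)"
        by (metis mod_eq_dvd_iff zmod_int)
      ultimately show "y = z"
        by (simp add: dvd_diff_less_iff)
    qed
    moreover have "(\<lambda>y. (y + s) mod n) ` {..<n} \<subseteq> {..<n}"
      using n by auto
    ultimately show ?thesis
      by (simp add: bij_betw_def endo_inj_surj)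
  qed
  have eigen: "?\<chi> $ y = unity_exp n (- int s) * ?\<chi> $ ((y + s) mod n)" if "y < n" for y
  proof -
    have "unity_exp n (int y) = unity_exp n (- int s) * unity_exp n (int ((y + s) mod n))"
      unfolding unity_exp_add [symmetric] by (rule unity_exp_cong) (simp add: zmod_int minus_mod_eq_mult_div algebra_simps)
    then show ?thesis
      using that assms n by (simp add: qft_ket_index del: index_mult_mat_vec)
  qed
  \<comment> \<open>With \<open>eigen\<close>, both factors depend on \<open>y\<close> only through
    \<open>(y + s) mod n\<close>, which makes the sum ready for reindexing by
    \<open>bij\<close>.\<close>
  have "(\<Sum>y<n. ket n ((y + s) mod n) $ j * ?\<chi> $ y) =
      (\<Sum>y<n. unity_exp n (- int s) * (ket n ((y + s) mod n) $ j * ?\<chi> $ ((y + s) mod n)))"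
    by (intro sum.cong refl)
      (simp only: lessThan_iff mult.left_commute [of "unity_exp n (- int s)"] flip: eigen)
  also have "\<dots> = (\<Sum>y<n. unity_exp n (- int s) * (ket n y $ j * ?\<chi> $ y))"
    by (rule sum.reindex_bij_betw [OF bij])
  also have "\<dots> = (\<Sum>y<n. if y = j then unity_exp n (- int s) * ?\<chi> $ j else 0)"
    using assms by (intro sum.cong) (auto simp: ket_def)
  finally show ?thesis
    using assms by simp
qed

lemma oracle_op_phase_kickback:
  assumes "n \<ge> 2" "dim_vec v = n ^ r"
  shows "oracle_op n r f *\<^sub>v (v \<otimes>\<^sub>v (qft n *\<^sub>v ket n 1)) =
    reg_superpos n r (\<lambda>x. (v \<bullet>c ket_reg n r x) * unity_exp n (- int (f x))) \<otimes>\<^sub>v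
    (qft n *\<^sub>v ket n 1)"
    (is "_ = ?w \<otimes>\<^sub>v _")
proof (rule eq_vecI)
  let ?\<chi> = "qft n *\<^sub>v ket n 1"
  let ?K = "\<lambda>x y. ket_reg n r x \<otimes>\<^sub>v ket n y"
  fix i assume "i < dim_vec (?w \<otimes>\<^sub>v ?\<chi>)"
  then have i: "i < n ^ r * n" by simp
  then have i': "i div n < n ^ r" "i mod n < n"
    using assms by (auto simp: less_mult_imp_div_less)
  have "(oracle_op n r f *\<^sub>v (v \<otimes>\<^sub>v ?\<chi>)) $ i =
      (\<Sum>j<n ^ r * n. \<Sum>x\<in>Zpow n r. \<Sum>y<n.
        ?K x ((y + f x) mod n) $ i * ((v \<otimes>\<^sub>v ?\<chi>) $ j * cnj (?K x y $ j)))"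
    using i assms by (simp add: oracle_op_def scalar_prod_def lessThan_atLeast0 sum_distrib_right
        sum_distrib_left mult_ac)
  \<comment> \<open>Moving the sum over \<open>j\<close> innermost collects it into an inner
    product, which then factors over the two registers.\<close>
  also have "\<dots> = (\<Sum>x\<in>Zpow n r. \<Sum>y<n. ?K x ((y + f x) mod n) $ i * ((v \<otimes>\<^sub>v ?\<chi>) \<bullet>c ?K x y))"
    by (subst sum.swap, rule sum.cong [OF refl], subst sum.swap)
      (simp add: scalar_prod_def lessThan_atLeast0 sum_distrib_left)
  also have "\<dots> = (\<Sum>x\<in>Zpow n r. \<Sum>y<n. ket_reg n r x $ (i div n) * (v \<bullet>c ket_reg n r x) *
      (ket n ((y + f x) mod n) $ (i mod n) * ?\<chi> $ y))"
    using i assms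
    by (intro sum.cong refl, subst cscalar_tensor_vec)
      (simp_all add: cscalar_ket_right tensor_vec_def del: index_mult_mat_vec)
  \<comment> \<open>For fixed \<open>x\<close>, the sum over \<open>y\<close> is a translation by
    \<open>s = f x\<close>, hence only a phase.\<close>
  also have "\<dots> = (\<Sum>x\<in>Zpow n r. ket_reg n r x $ (i div n) * (v \<bullet>c ket_reg n r x) *
      (unity_exp n (- int (f x)) * ?\<chi> $ (i mod n)))"
    unfolding sum_distrib_left [symmetric] using assms i' by (simp only: translate_qft_ket_1)
  also have "\<dots> = (?w \<otimes>\<^sub>v ?\<chi>) $ i"
    using i i' by (simp add: tensor_vec_def reg_superpos_def sum_distrib_left sum_distrib_right
        mult_ac del: index_mult_mat_vec)
  finally show "(oracle_op n r f *\<^sub>v (v \<otimes>\<^sub>v ?\<chi>)) $ i = (?w \<otimes>\<^sub>v ?\<chi>) $ i" .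
qed (simp add: oracle_op_def)

section \<open>The output state and its amplitudes\<close>

text \<open>The \<open>x\<close>-factor of the output: the uniform superposition after the oracle
  has attached its phases, transformed once more.\<close>

definition dj_reg :: "nat \<Rightarrow> nat \<Rightarrow> ((nat \<Rightarrow> nat) \<Rightarrow> nat) \<Rightarrow> complex vec" where
  "dj_reg n r f = tensor_pow (qft n) r *\<^sub>v
     reg_superpos n r (\<lambda>x. unity_exp n (- int (f x)) / sqrt n ^ r)"

lemma dim_dj_reg [simp]: "dim_vec (dj_reg n r f) = n ^ r"
  by (simp add: dj_reg_def)

lemma dj_state_eq:
  assumes "n \<ge> 2"
  shows "dj_state n r f = dj_reg n r f \<otimes>\<^sub>v ket n (n - 1)"
proof -
  \<comment> \<open>The initial register is zero, so every exponent vanishes and the superposition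
    is uniform.\<close>
  have "(tensor_pow (qft n) r *\<^sub>v ket_reg n r (\<lambda>i\<in>{1..r}. 0)) \<bullet>c ket_reg n r x = 1 / sqrt n ^ r"
    if "x \<in> Zpow n r" for x
    using that assms by (subst tensor_pow_qft_ket_reg) (auto simp: Zpow_def)
  then have "reg_superpos n r (\<lambda>x.
        ((tensor_pow (qft n) r *\<^sub>v ket_reg n r (\<lambda>i\<in>{1..r}. 0)) \<bullet>c ket_reg n r x) *
        unity_exp n (- int (f x))) =
      reg_superpos n r (\<lambda>x. unity_exp n (- int (f x)) / sqrt n ^ r)"
    by (simp add: reg_superpos_def)
  moreover have "tensor_pow (qft n) (r + 1) = tensor_pow (qft n) r \<otimes>\<^sub>m qft n"
    by simp
  ultimately show ?thesis
    using assms by (simp add: dj_state_def dj_reg_def tensor_mat_mult_vec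
        oracle_op_phase_kickback qft_qft_ket_1 del: One_nat_def)
qed

text \<open>One factor \<open>1 / sqrt n ^ r\<close> comes from the preparation and one from the
  last transform; together they make the sum an average.\<close>

lemma dj_reg_cscalar:
  assumes "n > 0" "a \<in> Zpow n r"
  shows "dj_reg n r f \<bullet>c ket_reg n r a =
    (\<Sum>x\<in>Zpow n r. unity_exp n ((\<Sum>i=1..r. int (a i) * int (x i)) - int (f x))) / of_nat n ^ r"
proof -
  have "complex_of_real (sqrt n) ^ r * complex_of_real (sqrt n) ^ r = of_nat n ^ r"
    by (simp flip: power_mult_distrib of_real_mult)
  then show ?thesis
    using assms unfolding dj_reg_def sum_divide_distrib
    by (subst mult_reg_superpos_cscalar, simp, simp, simp, intro sum.cong refl,
        subst tensor_pow_qft_ket_reg)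
      (auto simp: Zpow_def simp flip: unity_exp_add)
qed

text \<open>By orthogonality of the \<open>y\<close>-basis only the term \<open>y = j\<close>
  survives.\<close>

lemma prob_x_outcome_tensor_ket:
  assumes "dim_vec v = n ^ r" "j < n"
  shows "prob_x_outcome n r (v \<otimes>\<^sub>v ket n j) a = (cmod (v \<bullet>c ket_reg n r a))\<^sup>2"
proof -
  have "prob_x_outcome n r (v \<otimes>\<^sub>v ket n j) a =
      (\<Sum>y<n. if y = j then (cmod (v \<bullet>c ket_reg n r a))\<^sup>2 else 0)"
    unfolding prob_x_outcome_def using assms
    by (intro sum.cong) (auto simp: cscalar_tensor_vec cscalar_ket)
  then show ?thesis
    using assms by simp
qed

section \<open>Constant, balanced and affine functions\<close>

lemma card_Zpow: "card (Zpow n r) = n ^ r"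
  by (simp add: Zpow_def card_PiE)

lemma zero_in_Zpow: "n > 0 \<Longrightarrow> (\<lambda>i\<in>{1..r}. 0) \<in> Zpow n r"
  by (auto simp: Zpow_def)

text \<open>At the zero outcome the average runs over equal phases, so it is that phase.\<close>

lemma dj_reg_constant:
  assumes "n > 0" "constant_fun n r f"
  shows "cmod (dj_reg n r f \<bullet>c ket_reg n r (\<lambda>i\<in>{1..r}. 0)) = 1"
proof -
  let ?z = "\<lambda>i\<in>{1..r}. 0::nat"
  have "dj_reg n r f \<bullet>c ket_reg n r ?z = (\<Sum>x\<in>Zpow n r. unity_exp n (- int (f x))) / of_nat n ^ r"
    using assms by (subst dj_reg_cscalar) (simp_all add: zero_in_Zpow del: One_nat_def)
  also have "(\<Sum>x\<in>Zpow n r. unity_exp n (- int (f x))) = (\<Sum>x\<in>Zpow n r. unity_exp n (- int (f ?z)))"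
    using assms zero_in_Zpow unfolding constant_fun_def by (intro sum.cong) metis+
  also have "\<dots> / of_nat n ^ r = unity_exp n (- int (f ?z))"
    using assms by (simp add: card_Zpow)
  finally show ?thesis
    by (simp only: norm_unity_exp)
qed

text \<open>Grouping by the value of \<open>f\<close> gives every value the same weight, which
  leaves a multiple of a full sum of a nontrivial character.\<close>

lemma dj_reg_balanced:
  assumes "n \<ge> 2" "f \<in> Zpow n r \<rightarrow> {..<n}" "balanced_fun n r f"
  shows "dj_reg n r f \<bullet>c ket_reg n r (\<lambda>i\<in>{1..r}. 0) = 0"
proof -
  have "(\<Sum>x\<in>Zpow n r. unity_exp n (- int (f x))) =
      (\<Sum>z<n. \<Sum>x | x \<in> Zpow n r \<and> f x = z. unity_exp n (- int (f x)))"
    using assms by (subst sum.group) auto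
  also have "\<dots> = (\<Sum>z<n. of_nat (n ^ (r - 1)) * unity_exp n (- 1 * int z))"
    using assms by (intro sum.cong) (auto simp: balanced_fun_def)
  \<comment> \<open>The character has \<open>k = - 1\<close>, which \<open>n\<close> does not divide
    because \<open>n \<ge> 2\<close>.\<close>
  also have "\<dots> = 0"
    using assms unfolding sum_distrib_left [symmetric] by (subst sum_unity_exp) auto
  finally show ?thesis
    using assms by (subst dj_reg_cscalar) (simp_all add: zero_in_Zpow del: One_nat_def)
qed

text \<open>The summand is a product of characters of the coordinates, so the sum over tuples
  factors into \<open>r\<close> sums over single residues.\<close>

lemma sum_Zpow_character:
  assumes "n > 0"
  shows "(\<Sum>x\<in>Zpow n r. unity_exp n (\<Sum>i=1..r. k i * int (x i))) =
    (if \<forall>i\<in>{1..r}. int n dvd k i then of_nat n ^ r else 0)"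
proof -
  have "(\<Sum>x\<in>Zpow n r. unity_exp n (\<Sum>i=1..r. k i * int (x i))) =
      (\<Prod>i=1..r. \<Sum>z<n. unity_exp n (k i * int z))"
    unfolding Zpow_def by (subst prod_sum_PiE) (simp_all add: unity_exp_sum)
  also have "\<dots> = (\<Prod>i=1..r. if int n dvd k i then of_nat n else 0)"
    using assms by (simp add: sum_unity_exp)
  also have "\<dots> = (if \<forall>i\<in>{1..r}. int n dvd k i then of_nat n ^ r else 0)"
    by auto
  finally show ?thesis .
qed

text \<open>Modulo \<open>n\<close> the exponent is \<open>- A 0\<close> plus a linear form in
  \<open>x\<close> with coefficients \<open>a i - A i\<close>. Its character sum vanishes unless
  \<open>a\<close> agrees with \<open>A\<close>, where normalisation leaves only the phase.\<close>

lemma dj_reg_affine: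
  assumes n: "n > 0" and A: "\<forall>i\<in>{0..r}. A i < n"
    and f: "\<forall>x\<in>Zpow n r. f x = (A 0 + (\<Sum>i=1..r. A i * x i)) mod n"
  shows "dj_reg n r f = unity_exp n (- int (A 0)) \<cdot>\<^sub>v ket_reg n r (restrict A {1..r})"
proof (rule vec_eq_ket_regI)
  fix a assume a: "a \<in> Zpow n r"
  have "unity_exp n ((\<Sum>i=1..r. int (a i) * int (x i)) - int (f x)) =
      unity_exp n (- int (A 0)) * unity_exp n (\<Sum>i=1..r. (int (a i) - int (A i)) * int (x i))"
    if "x \<in> Zpow n r" for x
  proof -
    let ?s = "A 0 + (\<Sum>i=1..r. A i * x i)"
    have "int n dvd int ?s - int (f x)"
      using f that by (simp only: zmod_int minus_mod_eq_mult_div dvd_triv_left)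
    \<comment> \<open>The two exponents differ exactly by the multiple of \<open>n\<close> removed
      in reducing \<open>?s\<close> to \<open>f x\<close>.\<close>
    moreover have "(\<Sum>i=1..r. int (a i) * int (x i)) - int (f x) -
        (- int (A 0) + (\<Sum>i=1..r. (int (a i) - int (A i)) * int (x i))) = int ?s - int (f x)"
      by (simp add: left_diff_distrib sum_subtractf)
    ultimately show ?thesis
      unfolding unity_exp_add [symmetric] by (intro unity_exp_cong) (simp only:)
  qed
  then have "dj_reg n r f \<bullet>c ket_reg n r a = unity_exp n (- int (A 0)) *
      (if \<forall>i\<in>{1..r}. int n dvd int (a i) - int (A i) then 1 else 0)"
    using n a
    by (simp add: dj_reg_cscalar sum_Zpow_character del: One_nat_def flip: sum_distrib_left)
  also have "(\<forall>i\<in>{1..r}. int n dvd int (a i) - int (A i)) \<longleftrightarrow> (\<forall>i\<in>{1..r}. A i = a i)"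
  proof (rule ball_cong [OF refl])
    fix i assume "i \<in> {1..r}"
    then have "a i < n" "A i < n"
      using a A by (auto simp: Zpow_def PiE_iff)
    then show "int n dvd int (a i) - int (A i) \<longleftrightarrow> A i = a i"
      by (auto simp: dvd_diff_less_iff)
  qed
  also have "unity_exp n (- int (A 0)) * (if \<forall>i\<in>{1..r}. A i = a i then 1 else 0) =
      (unity_exp n (- int (A 0)) \<cdot>\<^sub>v ket_reg n r (restrict A {1..r})) \<bullet>c ket_reg n r a"
  proof -
    have "ket_reg n r (restrict A {1..r}) \<bullet>c ket_reg n r a =
        (if \<forall>i\<in>{1..r}. restrict A {1..r} i = a i then 1 else 0)"
      by (rule cscalar_ket_reg) (use a A in \<open>auto simp: Zpow_def PiE_iff\<close>)
    then show ?thesis by simp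
  qed
  finally show "dj_reg n r f \<bullet>c ket_reg n r a =
      (unity_exp n (- int (A 0)) \<cdot>\<^sub>v ket_reg n r (restrict A {1..r})) \<bullet>c ket_reg n r a" .
qed simp_all

lemma smult_tensor_vec: "(c \<cdot>\<^sub>v v) \<otimes>\<^sub>v w = c \<cdot>\<^sub>v (v \<otimes>\<^sub>v w)"
proof (rule eq_vecI)
  fix i assume "i < dim_vec (c \<cdot>\<^sub>v (v \<otimes>\<^sub>v w))"
  then show "((c \<cdot>\<^sub>v v) \<otimes>\<^sub>v w) $ i = (c \<cdot>\<^sub>v (v \<otimes>\<^sub>v w)) $ i"
    by (simp add: tensor_vec_def less_mult_imp_div_less)
qed simp

section \<open>Measurement statistics of the circuit\<close>

theorem theorem2:
  fixes n r :: nat and f :: "(nat \<Rightarrow> nat) \<Rightarrow> nat" and \<omega> :: complex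
  assumes "n \<ge> 2" and "r \<ge> 1"
    and "f \<in> Zpow n r \<rightarrow> {..<n}"
    and "\<omega> = exp (2 * complex_of_real pi * \<i> / of_nat n)"
  shows
    "(constant_fun n r f \<longrightarrow> prob_x_outcome n r (dj_state n r f) (\<lambda>i\<in>{1..r}. 0) = 1) \<and>
     (balanced_fun n r f \<longrightarrow> prob_x_outcome n r (dj_state n r f) (\<lambda>i\<in>{1..r}. 0) = 0) \<and>
     (\<forall>A :: nat \<Rightarrow> nat.
        (\<forall>i\<in>{0..r}. A i < n) \<and>
        (\<forall>x\<in>Zpow n r. f x = (A 0 + (\<Sum>i=1..r. A i * x i)) mod n) \<longrightarrow>
          dj_state n r f =
            \<omega> powi (- int (A 0)) \<cdot>\<^sub>v (ket_reg n r (restrict A {1..r}) \<otimes>\<^sub>v ket n (n - 1)) \<and>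
          dj_state n r f =
            (\<omega> powi (- int (A 0)) \<cdot>\<^sub>v ket_reg n r (restrict A {1..r})) \<otimes>\<^sub>v ket n (n - 1) \<and>
          prob_x_outcome n r (dj_state n r f) (restrict A {1..r}) = 1)"
proof (intro conjI impI allI)
  have n: "n > 0" "n - 1 < n" using assms by simp_all
  have prob: "prob_x_outcome n r (dj_state n r f) a = (cmod (dj_reg n r f \<bullet>c ket_reg n r a))\<^sup>2" for a
    using assms n by (simp add: dj_state_eq prob_x_outcome_tensor_ket)
  show "prob_x_outcome n r (dj_state n r f) (\<lambda>i\<in>{1..r}. 0) = 1" if "constant_fun n r f"
    using that n dj_reg_constant [of n r f] by (simp only: prob power_one)
  show "prob_x_outcome n r (dj_state n r f) (\<lambda>i\<in>{1..r}. 0) = 0" if "balanced_fun n r f"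
    using that assms dj_reg_balanced [of n f r] by (simp only: prob) simp
  fix A :: "nat \<Rightarrow> nat"
  assume A: "(\<forall>i\<in>{0..r}. A i < n) \<and>
    (\<forall>x\<in>Zpow n r. f x = (A 0 + (\<Sum>i=1..r. A i * x i)) mod n)"
  then have reg: "dj_reg n r f = \<omega> powi (- int (A 0)) \<cdot>\<^sub>v ket_reg n r (restrict A {1..r})"
    using n dj_reg_affine [of n r A f] by (simp add: assms(4) powi_exp_eq_unity_exp del: One_nat_def)
  show state: "dj_state n r f =
      (\<omega> powi (- int (A 0)) \<cdot>\<^sub>v ket_reg n r (restrict A {1..r})) \<otimes>\<^sub>v ket n (n - 1)"
    using assms by (simp only: dj_state_eq reg)
  then show "dj_state n r f =
      \<omega> powi (- int (A 0)) \<cdot>\<^sub>v (ket_reg n r (restrict A {1..r}) \<otimes>\<^sub>v ket n (n - 1))"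
    by (simp only: smult_tensor_vec)
  have "ket_reg n r (restrict A {1..r}) \<bullet>c ket_reg n r (restrict A {1..r}) = 1"
    using A by (subst cscalar_ket_reg) auto
  moreover have "cmod (\<omega> powi (- int (A 0))) = 1"
    \<comment> \<open>The phase carrying \<open>A 0\<close> has modulus 1 and so disappears from the
      probability.\<close>
    by (simp only: assms(4) powi_exp_eq_unity_exp norm_unity_exp)
  ultimately show "prob_x_outcome n r (dj_state n r f) (restrict A {1..r}) = 1"
    by (simp add: prob reg norm_mult)
qed

end
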